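(* For all labeled posets $(P,\omega)$ and $(Q,\psi)$, $$(P\oplus Q,\omega\oplus\psi)\sim(Q\oplus P,\psi\oplus\omega).$$
   Context: All posets are finite. A labeled poset $(P,\omega)$ is a poset $P$ with a bijection $\omega:P\to[|P|]=\{1,\dots,|P|\}$. Its order polynomial $\Omega_{P,\omega}(m)$ is the number of maps $f:P\to[m]$ with $f(x)\le f(y)$ whenever $x\le y$, and $f(x)<f(y)$ whenever $x<y$ and $\omega(x)>\omega(y)$; it is a polynomial in $m$. Write $(P,\omega)\sim(Q,\psi)$ when $\Omega_{P,\omega}=\Omega_{Q,\psi}$. The ordinal sum $P\oplus Q$ is the poset on the disjoint union of $P$ and $Q$ that keeps the relations of $P$ and of $Q$ and adds $x\le y$ for all $x\in P$, $y\in Q$. The labeling $\omega\oplus\psi$ of $P\oplus Q$ is $(\omega\oplus\psi)(x)=\omega(x)$ for $x\in P$ and $(\omega\oplus\psi)(x)=|P|+\psi(x)$ for $x\in Q$. *)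

theory Defs
  imports "HOL-Library.FuncSet"
begin

record 'a lposet =
  elems :: "'a set"
  le :: "'a rel"
  label :: "'a \<Rightarrow> nat"

definition labeled_poset :: "'a lposet \<Rightarrow> bool" where
  "labeled_poset P \<longleftrightarrow>
     finite (elems P) \<and> partial_order_on (elems P) (le P) \<and>
     bij_betw (label P) (elems P) {1..card (elems P)}"

text \<open>Extensional function spaces are used so that maps are counted only by their values
  on the elements of the poset.\<close>

definition order_preserving_maps :: "'a lposet \<Rightarrow> nat \<Rightarrow> ('a \<Rightarrow> nat) set" where
  "order_preserving_maps P m =
     {f \<in> elems P \<rightarrow>\<^sub>E {1..m}.
        (\<forall>(x, y) \<in> le P. f x \<le> f y) \<and>
        (\<forall>(x, y) \<in> le P. x \<noteq> y \<and> label P x > label P y \<longrightarrow> f x < f y)}"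

text \<open>The order polynomial is represented by its values at the natural numbers, which
  determine it.\<close>

definition order_polynomial :: "'a lposet \<Rightarrow> nat \<Rightarrow> nat" where
  "order_polynomial P m = card (order_preserving_maps P m)"

definition order_equiv :: "'a lposet \<Rightarrow> 'b lposet \<Rightarrow> bool" where
  "order_equiv P Q \<longleftrightarrow> order_polynomial P = order_polynomial Q"

definition ordinal_sum :: "'a lposet \<Rightarrow> 'b lposet \<Rightarrow> ('a + 'b) lposet" where
  "ordinal_sum P Q =
     \<lparr> elems = elems P <+> elems Q,
       le = {(Inl x, Inl y) | x y. (x, y) \<in> le P} \<union>
            {(Inr x, Inr y) | x y. (x, y) \<in> le Q} \<union>
            {(Inl x, Inr y) | x y. x \<in> elems P \<and> y \<in> elems Q},
       label = case_sum (label P) (\<lambda>x. card (elems P) + label Q x) \<rparr>"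

lemma labeled_poset_ordinal_sum:
  assumes "labeled_poset P" and "labeled_poset Q"
  shows "labeled_poset (ordinal_sum P Q)"
proof -
  let ?S = "ordinal_sum P Q"
  let ?n = "card (elems P)" and ?k = "card (elems Q)"
  have fin: "finite (elems P)" "finite (elems Q)"
    and ord: "partial_order_on (elems P) (le P)" "partial_order_on (elems Q) (le Q)"
    and bij: "bij_betw (label P) (elems P) {1..?n}" "bij_betw (label Q) (elems Q) {1..?k}"
    using assms by (auto simp: labeled_poset_def)
  have sub: "le P \<subseteq> elems P \<times> elems P" "le Q \<subseteq> elems Q \<times> elems Q"
    using ord by (auto dest: partial_order_onD(4))
  have "le ?S \<subseteq> elems ?S \<times> elems ?S"
    using sub by (auto simp: ordinal_sum_def)
  moreover have "refl_on (elems ?S) (le ?S)"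
    using ord[THEN partial_order_onD(1)] by (auto simp: ordinal_sum_def refl_on_def)
  moreover have "trans (le ?S)"
    using ord[THEN partial_order_onD(2)] sub
    by (intro transI) (auto simp: ordinal_sum_def dest: transD)
  moreover have "antisym (le ?S)"
    using ord[THEN partial_order_onD(3)]
    by (intro antisymI) (auto simp: ordinal_sum_def dest: antisymD)
  ultimately have po: "partial_order_on (elems ?S) (le ?S)"
    by (simp add: partial_order_on_def preorder_on_def)
  have l: "bij_betw (label ?S) (Inl ` elems P) {1..?n}"
    using bij(1) by (auto simp: bij_betw_def inj_on_def image_image ordinal_sum_def)
  have "bij_betw (\<lambda>x. ?n + label Q x) (elems Q) {?n + 1..?n + ?k}"
    using bij_betw_trans[OF bij(2), of "(+) ?n" "{?n + 1..?n + ?k}"]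
    by (simp add: o_def bij_betw_def)
  then have r: "bij_betw (label ?S) (Inr ` elems Q) {?n + 1..?n + ?k}"
    by (auto simp: bij_betw_def inj_on_def image_image ordinal_sum_def)
  have "bij_betw (label ?S) (Inl ` elems P \<union> Inr ` elems Q) ({1..?n} \<union> {?n + 1..?n + ?k})"
    using bij_betw_combine[OF l r] by auto
  moreover have "{1..?n} \<union> {?n + 1..?n + ?k} = {1..?n + ?k}"
    by auto
  moreover have "card (elems ?S) = ?n + ?k"
    using fin by (simp add: ordinal_sum_def card_Plus)
  moreover have "elems ?S = Inl ` elems P \<union> Inr ` elems Q"
    by (simp add: ordinal_sum_def Plus_def)
  ultimately show ?thesis
    using po fin by (simp add: labeled_poset_def)
qed

end

theory Submission
  imports Defs
begin

text \<open>
  Since every label of the lower summand is smaller than every label of the upper one, the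
  relations that the ordinal sum adds are weak. Hence a map on \<open>P \<oplus> Q\<close> is a pair of maps
  \<open>f\<close> on \<open>P\<close> and \<open>g\<close> on \<open>Q\<close> such that every value of \<open>f\<close> is at most every value of \<open>g\<close>
  (\<open>order_polynomial_ordinal_sum_eq_card_pairs\<close>).

  Such pairs are counted by the Euler characteristic of an interval. For any pair \<open>(f, g)\<close>,
  the thresholds \<open>k\<close> in \<open>{1..m}\<close> with \<open>f \<le> k \<le> g\<close> form an interval \<open>{a..b}\<close>, and those
  in \<open>{1..<m}\<close> with \<open>f \<le> k < g\<close> form \<open>{a..<b}\<close> (\<open>card_thresholds_between\<close>).
  If \<open>f \<le> g\<close>, then there is one more of the former than of the latter; otherwise there
  are none of either kind. Now sum over all pairs and exchange the summations. For fixed \<open>k\<close>, the maps \<open>f \<le> k\<close> number \<open>\<Omega>\<^sub>P(k)\<close>, and by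
  translation the maps \<open>g \<ge> k\<close> and \<open>g > k\<close> number \<open>\<Omega>\<^sub>Q(m + 1 - k)\<close> and \<open>\<Omega>\<^sub>Q(m - k)\<close>.
  Therefore, for \<open>m \<ge> 1\<close>, the order polynomial of \<open>P \<oplus> Q\<close> at \<open>m\<close> is
  \<open>(\<Sum>k=1..m. \<Omega>\<^sub>P(k) \<Omega>\<^sub>Q(m + 1 - k)) - (\<Sum>k=1..m-1. \<Omega>\<^sub>P(k) \<Omega>\<^sub>Q(m - k))\<close>
  (\<open>order_polynomial_ordinal_sum\<close>).
  Both sums are convolutions, so reversing the order of summation exchanges \<open>P\<close> and \<open>Q\<close>.
  At \<open>m = 0\<close> the formula can fail, but there the value only says whether the poset is empty.
\<close>

section \<open>Order-preserving maps\<close>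

lemma finite_order_preserving_maps:
  assumes "labeled_poset P"
  shows "finite (order_preserving_maps P m)"
proof -
  have "finite (elems P \<rightarrow>\<^sub>E {1..m})"
    using assms by (simp add: labeled_poset_def finite_PiE)
  then show ?thesis
    by (simp add: order_preserving_maps_def)
qed

lemma order_preserving_mapsI:
  assumes "f \<in> elems P \<rightarrow>\<^sub>E {1..m}"
    and "\<And>x y. (x, y) \<in> le P \<Longrightarrow> f x \<le> f y"
    and "\<And>x y. (x, y) \<in> le P \<Longrightarrow> x \<noteq> y \<Longrightarrow> label P x > label P y \<Longrightarrow> f x < f y"
  shows "f \<in> order_preserving_maps P m"
  using assms unfolding order_preserving_maps_def by blast

lemma order_preserving_mapsD:
  assumes "f \<in> order_preserving_maps P m"
  shows "f \<in> elems P \<rightarrow>\<^sub>E {1..m}"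
    and "(x, y) \<in> le P \<Longrightarrow> f x \<le> f y"
    and "(x, y) \<in> le P \<Longrightarrow> x \<noteq> y \<Longrightarrow> label P x > label P y \<Longrightarrow> f x < f y"
  using assms by (auto simp: order_preserving_maps_def)

lemma labeled_poset_le_elems:
  assumes "labeled_poset P" and "(x, y) \<in> le P"
  shows "x \<in> elems P" and "y \<in> elems P"
  using assms by (auto simp: labeled_poset_def dest: partial_order_onD(4))

lemma labeled_poset_label_le_card:
  assumes "labeled_poset P" and "x \<in> elems P"
  shows "label P x \<le> card (elems P)"
  using assms by (auto simp: labeled_poset_def bij_betw_def)

section \<open>Maps on an ordinal sum as pairs of maps\<close>

lemma le_ordinal_sum_cases:
  assumes "(u, v) \<in> le (ordinal_sum P Q)"
  obtains (lower) x y where "u = Inl x" "v = Inl y" "(x, y) \<in> le P"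
    | (upper) x y where "u = Inr x" "v = Inr y" "(x, y) \<in> le Q"
    | (across) x y where "u = Inl x" "v = Inr y" "x \<in> elems P" "y \<in> elems Q"
  using assms by (auto simp: ordinal_sum_def)

text \<open>The relations between the summands impose only weak inequalities, because labels
  increase from the lower summand to the upper one.\<close>

lemma order_polynomial_ordinal_sum_eq_card_pairs:
  assumes P: "labeled_poset P" and Q: "labeled_poset Q"
  shows "order_polynomial (ordinal_sum P Q) m =
    card {(f, g) \<in> order_preserving_maps P m \<times> order_preserving_maps Q m.
      \<forall>x \<in> elems P. \<forall>y \<in> elems Q. f x \<le> g y}"
proof -
  let ?split = "\<lambda>h. (restrict (h \<circ> Inl) (elems P), restrict (h \<circ> Inr) (elems Q))"
  let ?join = "\<lambda>(f, g). restrict (case_sum f g) (elems P <+> elems Q)"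
  have elems: "x \<in> elems P" "y \<in> elems P" if "(x, y) \<in> le P" for x y
    using labeled_poset_le_elems[OF P that] .
  have elems': "x \<in> elems Q" "y \<in> elems Q" if "(x, y) \<in> le Q" for x y
    using labeled_poset_le_elems[OF Q that] .
  have "bij_betw ?split (order_preserving_maps (ordinal_sum P Q) m)
    {(f, g) \<in> order_preserving_maps P m \<times> order_preserving_maps Q m.
      \<forall>x \<in> elems P. \<forall>y \<in> elems Q. f x \<le> g y}" (is "bij_betw _ ?H ?FG")
  proof (rule bij_betwI[where g = ?join])
    show "?split \<in> ?H \<rightarrow> ?FG"
    proof
      fix h assume h: "h \<in> ?H"
      have val: "h \<in> (elems P <+> elems Q) \<rightarrow>\<^sub>E {1..m}"
        using order_preserving_mapsD(1)[OF h] by (simp add: ordinal_sum_def)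
      note weak = order_preserving_mapsD(2)[OF h] and strict = order_preserving_mapsD(3)[OF h]
      have "restrict (h \<circ> Inl) (elems P) \<in> order_preserving_maps P m"
      proof (rule order_preserving_mapsI)
        show "restrict (h \<circ> Inl) (elems P) \<in> elems P \<rightarrow>\<^sub>E {1..m}"
          using val by (auto simp: PiE_iff)
        show "restrict (h \<circ> Inl) (elems P) x \<le> restrict (h \<circ> Inl) (elems P) y"
          if "(x, y) \<in> le P" for x y
          using weak[of "Inl x" "Inl y"] that elems[OF that] by (simp add: ordinal_sum_def)
        show "restrict (h \<circ> Inl) (elems P) x < restrict (h \<circ> Inl) (elems P) y"
          if "(x, y) \<in> le P" "x \<noteq> y" "label P x > label P y" for x y
          using strict[of "Inl x" "Inl y"] that elems[OF that(1)] by (simp add: ordinal_sum_def)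
      qed
      moreover have "restrict (h \<circ> Inr) (elems Q) \<in> order_preserving_maps Q m"
      proof (rule order_preserving_mapsI)
        show "restrict (h \<circ> Inr) (elems Q) \<in> elems Q \<rightarrow>\<^sub>E {1..m}"
          using val by (auto simp: PiE_iff)
        show "restrict (h \<circ> Inr) (elems Q) x \<le> restrict (h \<circ> Inr) (elems Q) y"
          if "(x, y) \<in> le Q" for x y
          using weak[of "Inr x" "Inr y"] that elems'[OF that] by (simp add: ordinal_sum_def)
        show "restrict (h \<circ> Inr) (elems Q) x < restrict (h \<circ> Inr) (elems Q) y"
          if "(x, y) \<in> le Q" "x \<noteq> y" "label Q x > label Q y" for x y
          using strict[of "Inr x" "Inr y"] that elems'[OF that(1)] by (simp add: ordinal_sum_def)
      qed
      moreover have "h (Inl x) \<le> h (Inr y)" if "x \<in> elems P" "y \<in> elems Q" for x y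
        using weak[of "Inl x" "Inr y"] that by (simp add: ordinal_sum_def)
      ultimately show "?split h \<in> ?FG"
        by simp
    qed
    show "?join \<in> ?FG \<rightarrow> ?H"
    proof
      fix p assume "p \<in> ?FG"
      then obtain f g where p: "p = (f, g)"
        and f: "f \<in> order_preserving_maps P m" and g: "g \<in> order_preserving_maps Q m"
        and cross: "\<And>x y. x \<in> elems P \<Longrightarrow> y \<in> elems Q \<Longrightarrow> f x \<le> g y"
        by auto
      let ?h = "restrict (case_sum f g) (elems P <+> elems Q)"
      have "?h \<in> (elems P <+> elems Q) \<rightarrow>\<^sub>E {1..m}"
        using f g by (fastforce simp: order_preserving_maps_def PiE_iff)
      moreover have "?h u \<le> ?h v" if "(u, v) \<in> le (ordinal_sum P Q)" for u v
        using that
      proof (cases rule: le_ordinal_sum_cases)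
        case (lower x y)
        then show ?thesis
          using order_preserving_mapsD(2)[OF f, of x y] elems[of x y] by auto
      next
        case (upper x y)
        then show ?thesis
          using order_preserving_mapsD(2)[OF g, of x y] elems'[of x y] by auto
      next
        case (across x y)
        then show ?thesis
          using cross by auto
      qed
      moreover have "?h u < ?h v" if "(u, v) \<in> le (ordinal_sum P Q)" and "u \<noteq> v"
        and "label (ordinal_sum P Q) u > label (ordinal_sum P Q) v" for u v
        using that(1)
      proof (cases rule: le_ordinal_sum_cases)
        case (lower x y)
        then show ?thesis
          using that(2,3) order_preserving_mapsD(3)[OF f, of x y] elems[of x y]
          by (auto simp: ordinal_sum_def)
      next
        case (upper x y)
        then show ?thesis
          using that(2,3) order_preserving_mapsD(3)[OF g, of x y] elems'[of x y]
          by (auto simp: ordinal_sum_def)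
      next
        case (across x y)
        then show ?thesis
          using that(3) labeled_poset_label_le_card[OF P, of x] by (auto simp: ordinal_sum_def)
      qed
      ultimately have "?h \<in> ?H"
        by (intro order_preserving_mapsI) (simp_all add: ordinal_sum_def)
      then show "?join p \<in> ?H"
        by (simp add: p)
    qed
    show "?join (?split h) = h" if "h \<in> ?H" for h
    proof -
      have "h \<in> extensional (elems P <+> elems Q)"
        using that by (simp add: order_preserving_maps_def ordinal_sum_def PiE_def)
      then show ?thesis
        by (auto simp: fun_eq_iff restrict_def extensional_def split: sum.split)
    qed
    show "?split (?join p) = p" if "p \<in> ?FG" for p
    proof -
      obtain f g where p: "p = (f, g)"
        by (cases p)
      have "f \<in> extensional (elems P)" "g \<in> extensional (elems Q)"
        using that by (auto simp: p order_preserving_maps_def PiE_def)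
      then show ?thesis
        by (auto simp: p fun_eq_iff restrict_def extensional_def)
    qed
  qed
  then show ?thesis
    unfolding order_polynomial_def by (rule bij_betw_same_card)
qed

section \<open>Maps with bounded values\<close>

lemma order_preserving_maps_bounded_above:
  assumes "k \<le> m"
  shows "{f \<in> order_preserving_maps P m. \<forall>x \<in> elems P. f x \<le> k} = order_preserving_maps P k"
  using assms by (fastforce simp: order_preserving_maps_def PiE_iff)

text \<open>Translation by \<open>j\<close> identifies \<open>{1..m - j}\<close> with the values above \<open>j\<close>.\<close>

lemma card_order_preserving_maps_bounded_below:
  assumes P: "labeled_poset P" and "j \<le> m"
  shows "card {g \<in> order_preserving_maps P m. \<forall>x \<in> elems P. j < g x} = order_polynomial P (m - j)"
proof -
  have elems: "x \<in> elems P" "y \<in> elems P" if "(x, y) \<in> le P" for x y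
    using labeled_poset_le_elems[OF P that] .
  let ?up = "\<lambda>g. restrict (\<lambda>x. g x + j) (elems P)"
  let ?down = "\<lambda>g. restrict (\<lambda>x. g x - j) (elems P)"
  have "bij_betw ?up (order_preserving_maps P (m - j))
    {g \<in> order_preserving_maps P m. \<forall>x \<in> elems P. j < g x}" (is "bij_betw _ ?F ?G")
  proof (rule bij_betwI[where g = ?down])
    show "?up \<in> ?F \<rightarrow> ?G"
    proof
      fix f assume "f \<in> ?F"
      then show "?up f \<in> ?G"
        using elems \<open>j \<le> m\<close> by (fastforce simp: order_preserving_maps_def PiE_iff)
    qed
    show "?down \<in> ?G \<rightarrow> ?F"
    proof
      fix g assume g: "g \<in> ?G"
      then have "?down g \<in> elems P \<rightarrow>\<^sub>E {1..m - j}"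
        by (fastforce simp: order_preserving_maps_def PiE_iff)
      moreover have "?down g x \<le> ?down g y" if "(x, y) \<in> le P" for x y
        using g that elems[OF that] by (auto simp: order_preserving_maps_def intro: diff_le_mono)
      moreover have "?down g x < ?down g y"
        if "(x, y) \<in> le P" "x \<noteq> y" "label P x > label P y" for x y
        using g that elems[OF that(1)]
        by (auto simp: order_preserving_maps_def less_imp_le intro!: diff_less_mono)
      ultimately show "?down g \<in> ?F"
        by (rule order_preserving_mapsI)
    qed
    show "?down (?up f) = f" if "f \<in> ?F" for f
      using that
      by (auto simp: order_preserving_maps_def PiE_def extensional_def fun_eq_iff restrict_def)
    show "?up (?down g) = g" if "g \<in> ?G" for g
      using that
      by (auto simp: order_preserving_maps_def PiE_def extensional_def fun_eq_iff restrict_def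
          less_imp_le)
  qed
  then show ?thesis
    unfolding order_polynomial_def by (simp add: bij_betw_same_card)
qed

section \<open>Counting thresholds\<close>

text \<open>This is the Euler characteristic of an interval: a nonempty \<open>{a..b}\<close> has exactly one
  more point than \<open>{a..<b}\<close>. Adjoining \<open>1\<close> and \<open>m\<close> to the two sets provides the end points
  also when one of the sets is empty; for this \<open>{1..m}\<close> has to be nonempty.\<close>

lemma card_thresholds_between:
  fixes A B :: "nat set"
  assumes "1 \<le> m" and A: "A \<subseteq> {1..m}" and B: "B \<subseteq> {1..m}"
  shows "card {k \<in> {1..m}. (\<forall>a \<in> A. a \<le> k) \<and> (\<forall>b \<in> B. k \<le> b)} =
    card {k \<in> {1..<m}. (\<forall>a \<in> A. a \<le> k) \<and> (\<forall>b \<in> B. k < b)} +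
    of_bool (\<forall>a \<in> A. \<forall>b \<in> B. a \<le> b)"
proof -
  define a where "a = Max (insert 1 A)"
  define b where "b = Min (insert m B)"
  have fin: "finite A" "finite B"
    using A B finite_subset by blast+
  have weak: "{k \<in> {1..m}. (\<forall>a \<in> A. a \<le> k) \<and> (\<forall>b \<in> B. k \<le> b)} = {a..b}"
    using fin by (auto simp: a_def b_def)
  have strict: "{k \<in> {1..<m}. (\<forall>a \<in> A. a \<le> k) \<and> (\<forall>b \<in> B. k < b)} = {a..<b}"
    using fin by (auto simp: a_def b_def)
  have "(\<forall>a \<in> A. \<forall>b \<in> B. a \<le> b) \<longleftrightarrow> a \<le> b"
    using fin A B \<open>1 \<le> m\<close> by (auto simp: a_def b_def)
  then show ?thesis
    unfolding weak strict by (simp add: Suc_diff_le)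
qed

text \<open>Double counting of the triples \<open>(k, f, g)\<close> with \<open>L f k\<close> and \<open>U g k\<close>.\<close>

lemma sum_card_mult_eq_sum_card:
  assumes "finite F" and "finite G" and "finite K"
  shows "(\<Sum>k\<in>K. card {f \<in> F. L f k} * card {g \<in> G. U g k}) =
    (\<Sum>(f, g)\<in>F \<times> G. card {k \<in> K. L f k \<and> U g k})"
proof -
  have "(\<Sum>p\<in>F \<times> G. card {k \<in> K. L (fst p) k \<and> U (snd p) k}) =
    (\<Sum>k\<in>K. card {f \<in> F. L f k} * card {g \<in> G. U g k})"
  proof (rule sum_multicount_gen)
    show "\<forall>k\<in>K. card {p \<in> F \<times> G. L (fst p) k \<and> U (snd p) k} =
      card {f \<in> F. L f k} * card {g \<in> G. U g k}"
    proof
      fix k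
      have "{p \<in> F \<times> G. L (fst p) k \<and> U (snd p) k} = {f \<in> F. L f k} \<times> {g \<in> G. U g k}"
        by auto
      then show "card {p \<in> F \<times> G. L (fst p) k \<and> U (snd p) k} =
        card {f \<in> F. L f k} * card {g \<in> G. U g k}"
        by (simp add: card_cartesian_product)
    qed
  qed (use assms in auto)
  then show ?thesis
    by (simp add: case_prod_unfold)
qed

section \<open>The convolution formula and its symmetry\<close>

text \<open>Count the triples of maps \<open>f\<close>, \<open>g\<close> and a threshold \<open>k\<close> between them, once weakly and
  once strictly below \<open>g\<close>; by \<open>card_thresholds_between\<close> the difference is the number of
  pairs with \<open>f \<le> g\<close>. The smaller sum stands on the left because subtraction truncates on the natural
  numbers.\<close>

lemma order_polynomial_ordinal_sum:
  assumes P: "labeled_poset P" and Q: "labeled_poset Q" and m: "1 \<le> m"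
  shows "order_polynomial (ordinal_sum P Q) m +
      (\<Sum>k=1..<m. order_polynomial P k * order_polynomial Q (m - k)) =
    (\<Sum>k=1..m. order_polynomial P k * order_polynomial Q (m + 1 - k))"
proof -
  let ?F = "order_preserving_maps P m" and ?G = "order_preserving_maps Q m"
  let ?ok = "\<lambda>f g. \<forall>x \<in> elems P. \<forall>y \<in> elems Q. f x \<le> g y"
  have fin: "finite ?F" "finite ?G"
    using finite_order_preserving_maps P Q by blast+
  have above: "card {f \<in> ?F. \<forall>x \<in> elems P. f x \<le> k} = order_polynomial P k" if "k \<le> m" for k
    using order_preserving_maps_bounded_above[OF that, of P] by (simp add: order_polynomial_def)
  have below: "card {g \<in> ?G. \<forall>y \<in> elems Q. k < g y} = order_polynomial Q (m - k)"
    if "k \<le> m" for k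
    using card_order_preserving_maps_bounded_below[OF Q that] .
  have below': "card {g \<in> ?G. \<forall>y \<in> elems Q. k \<le> g y} = order_polynomial Q (m + 1 - k)"
    if "k \<in> {1..m}" for k
  proof -
    have "k - 1 \<le> m"
      using that by auto
    from below[OF this] that show ?thesis
      by (simp add: Suc_le_eq[symmetric])
  qed
  have "(\<Sum>k=1..m. order_polynomial P k * order_polynomial Q (m + 1 - k)) =
    (\<Sum>k=1..m. card {f \<in> ?F. \<forall>x \<in> elems P. f x \<le> k} * card {g \<in> ?G. \<forall>y \<in> elems Q. k \<le> g y})"
    by (rule sum.cong) (simp_all only: above below' atLeastAtMost_iff)
  also have "\<dots> = (\<Sum>(f, g)\<in>?F \<times> ?G.
      card {k \<in> {1..m}. (\<forall>x \<in> elems P. f x \<le> k) \<and> (\<forall>y \<in> elems Q. k \<le> g y)})"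
    by (rule sum_card_mult_eq_sum_card) (use fin in auto)
  also have "\<dots> = (\<Sum>(f, g)\<in>?F \<times> ?G.
      card {k \<in> {1..<m}. (\<forall>x \<in> elems P. f x \<le> k) \<and> (\<forall>y \<in> elems Q. k < g y)} +
      of_bool (?ok f g))"
  proof (rule sum.cong[OF refl], clarify)
    fix f g assume "f \<in> ?F" "g \<in> ?G"
    then have "f ` elems P \<subseteq> {1..m}" "g ` elems Q \<subseteq> {1..m}"
      by (auto simp: order_preserving_maps_def PiE_iff)
    from card_thresholds_between[OF m this]
    show "card {k \<in> {1..m}. (\<forall>x \<in> elems P. f x \<le> k) \<and> (\<forall>y \<in> elems Q. k \<le> g y)} =
        card {k \<in> {1..<m}. (\<forall>x \<in> elems P. f x \<le> k) \<and> (\<forall>y \<in> elems Q. k < g y)} +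
        of_bool (?ok f g)"
      by simp
  qed
  also have "\<dots> = (\<Sum>(f, g)\<in>?F \<times> ?G.
        card {k \<in> {1..<m}. (\<forall>x \<in> elems P. f x \<le> k) \<and> (\<forall>y \<in> elems Q. k < g y)}) +
      (\<Sum>(f, g)\<in>?F \<times> ?G. of_bool (?ok f g))"
    by (simp add: case_prod_unfold sum.distrib)
  also have "(\<Sum>(f, g)\<in>?F \<times> ?G.
        card {k \<in> {1..<m}. (\<forall>x \<in> elems P. f x \<le> k) \<and> (\<forall>y \<in> elems Q. k < g y)}) =
    (\<Sum>k=1..<m. card {f \<in> ?F. \<forall>x \<in> elems P. f x \<le> k} * card {g \<in> ?G. \<forall>y \<in> elems Q. k < g y})"
    by (rule sum_card_mult_eq_sum_card[symmetric]) (use fin in auto)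
  also have "\<dots> = (\<Sum>k=1..<m. order_polynomial P k * order_polynomial Q (m - k))"
    by (rule sum.cong) (simp_all add: above below)
  also have "(\<Sum>(f, g)\<in>?F \<times> ?G. of_bool (?ok f g)) = card {(f, g) \<in> ?F \<times> ?G. ?ok f g}"
  proof -
    have "{(f, g) \<in> ?F \<times> ?G. ?ok f g} = (?F \<times> ?G) \<inter> {p. ?ok (fst p) (snd p)}"
      by auto
    then show ?thesis
      using fin by (simp add: case_prod_unfold sum_of_bool_eq)
  qed
  also have "\<dots> = order_polynomial (ordinal_sum P Q) m"
    by (rule order_polynomial_ordinal_sum_eq_card_pairs[OF P Q, symmetric])
  finally show ?thesis
    by simp
qed

lemma order_polynomial_0:
  assumes "labeled_poset P"
  shows "order_polynomial P 0 = of_bool (elems P = {})"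
proof (cases "elems P = {}")
  case True
  then have "le P = {}"
    using labeled_poset_le_elems[OF assms] by auto
  with True show ?thesis
    by (simp add: order_polynomial_def order_preserving_maps_def)
next
  case False
  then have "order_preserving_maps P 0 = {}"
    by (auto simp: order_preserving_maps_def PiE_iff)
  with False show ?thesis
    by (simp add: order_polynomial_def)
qed

theorem corollary1p4:
  fixes P :: "'a lposet" and Q :: "'b lposet"
  assumes "labeled_poset P" and "labeled_poset Q"
  shows "order_equiv (ordinal_sum P Q) (ordinal_sum Q P)"
proof -
  have "order_polynomial (ordinal_sum P Q) m = order_polynomial (ordinal_sum Q P) m" for m
  proof (cases "m = 0")
    case True
    then show ?thesis
      using order_polynomial_0[OF labeled_poset_ordinal_sum[OF assms]]
        order_polynomial_0[OF labeled_poset_ordinal_sum[OF assms(2,1)]]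
      by (auto simp: ordinal_sum_def)
  next
    case False
    let ?p = "order_polynomial P" and ?q = "order_polynomial Q"
    have "(\<Sum>k=1..m. ?p k * ?q (m + 1 - k)) = (\<Sum>k=1..m. ?q k * ?p (m + 1 - k))"
      by (rule sum.reindex_bij_witness[where i = "\<lambda>k. m + 1 - k" and j = "\<lambda>k. m + 1 - k"]) auto
    moreover have "(\<Sum>k=1..<m. ?p k * ?q (m - k)) = (\<Sum>k=1..<m. ?q k * ?p (m - k))"
      by (rule sum.reindex_bij_witness[where i = "\<lambda>k. m - k" and j = "\<lambda>k. m - k"]) auto
    moreover have "1 \<le> m"
      using False by simp
    ultimately show ?thesis
      using order_polynomial_ordinal_sum[OF assms, of m]
        order_polynomial_ordinal_sum[OF assms(2,1), of m]
      by simp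
  qed
  then show ?thesis
    by (simp add: order_equiv_def fun_eq_iff)
qed

end
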